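(* Let $G$ be an $n$-vertex cubic bipartite Pfaffian graph, $H$ a Hamiltonian cycle in $G$, and $e\in E(H)$. Then Thomason's lollipop method started from $H$ and $e$ terminates after at most $n$ lollipop steps.
   Context: All graphs are finite, undirected, simple. A cycle $C$ of $G$ is central if $G\setminus V(C)$ has a perfect matching; an orientation of a cycle is consistent if it is a directed cycle; an orientation $\vec G$ of $G$ (choosing one direction per edge) is Pfaffian if for every central cycle $C$ each of the two consistent orientations of $C$ shares an odd number of arcs with $\vec G$; $G$ is Pfaffian if it has a Pfaffian orientation. Thomason's lollipop method: Let $G$ be cubic with Hamiltonian cycle $H$ and $e=\{s,t\}\in E(H)$. An $e$-anchored Hamiltonian path is a Hamiltonian path of $G$ that starts at $t$ and whose first edge is $e$. A lollipop step from an $e$-anchored Hamiltonian path $Q$ ending at a vertex $u$: choose a neighbor $x\neq t$ of $u$ with $\{u,x\}\notin E(Q)$, add $\{u,x\}$ to $Q$ to obtain a lollipop (a connected graph with one degree-1 vertex $t$, one degree-3 vertex $x$, all others of degree 2); then delete the unique edge $\{v,x\}$ of this lollipop with $v\notin\{u,t\}$ whose removal leaves an $e$-anchored Hamiltonian path $Q'$ (ending at $v$). The method starts by deleting from $H$ the edge $\{t,u\}$ with $u\neq s$, obtaining the $e$-anchored Hamiltonian path $Q_0$ ending at $u$, and then performs lollipop steps $Q_0\to Q_1\to Q_2\to\cdots$, where each step $Q_i\to Q_{i+1}$ (for $i\ge1$) is the lollipop step other than the one returning to $Q_{i-1}$; it terminates at the first $Q_h$ ($h\ge1$) whose end vertex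 other than $t$ is a neighbor of $t$. The number of lollipop steps is $h$. *)

theory Defs
  imports Main
begin

text \<open>A graph is given by its vertex set \<open>V\<close> and its set \<open>E\<close> of edges, each edge being a two-element
  subset of \<open>V\<close>.\<close>

definition simple_graph :: "'a set \<Rightarrow> 'a set set \<Rightarrow> bool" where
  "simple_graph V E \<longleftrightarrow>
     finite V \<and> (\<forall>e\<in>E. \<exists>u v. u \<in> V \<and> v \<in> V \<and> u \<noteq> v \<and> e = {u, v})"

definition cubic :: "'a set \<Rightarrow> 'a set set \<Rightarrow> bool" where
  "cubic V E \<longleftrightarrow> (\<forall>v\<in>V. card {e \<in> E. v \<in> e} = 3)"

definition bipartite :: "'a set \<Rightarrow> 'a set set \<Rightarrow> bool" where
  "bipartite V E \<longleftrightarrow>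
     (\<exists>A B. A \<union> B = V \<and> A \<inter> B = {} \<and> (\<forall>e\<in>E. \<exists>a\<in>A. \<exists>b\<in>B. e = {a, b}))"

text \<open>A cycle is represented by a cyclic enumeration of its vertices, a path by the enumeration of
  its vertices from one end to the other. The list of a cycle also fixes one of its two consistent
  orientations; the reversed list gives the other one.\<close>

definition cycle_arcs :: "'a list \<Rightarrow> ('a \<times> 'a) set" where
  "cycle_arcs C = set (zip C (rotate1 C))"

definition path_arcs :: "'a list \<Rightarrow> ('a \<times> 'a) set" where
  "path_arcs Q = set (zip Q (tl Q))"

definition cycle_edges :: "'a list \<Rightarrow> 'a set set" where
  "cycle_edges C = (\<lambda>(u, v). {u, v}) ` cycle_arcs C"

definition path_edges :: "'a list \<Rightarrow> 'a set set" where
  "path_edges Q = (\<lambda>(u, v). {u, v}) ` path_arcs Q"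

definition is_cycle :: "'a set \<Rightarrow> 'a set set \<Rightarrow> 'a list \<Rightarrow> bool" where
  "is_cycle V E C \<longleftrightarrow> length C \<ge> 3 \<and> distinct C \<and> set C \<subseteq> V \<and> cycle_edges C \<subseteq> E"

definition hamiltonian_cycle :: "'a set \<Rightarrow> 'a set set \<Rightarrow> 'a list \<Rightarrow> bool" where
  "hamiltonian_cycle V E H \<longleftrightarrow> is_cycle V E H \<and> set H = V"

definition hamiltonian_path :: "'a set \<Rightarrow> 'a set set \<Rightarrow> 'a list \<Rightarrow> bool" where
  "hamiltonian_path V E Q \<longleftrightarrow> distinct Q \<and> set Q = V \<and> path_edges Q \<subseteq> E"

definition induced_edges :: "'a set set \<Rightarrow> 'a set \<Rightarrow> 'a set set" where
  "induced_edges E W = {e \<in> E. e \<subseteq> W}"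

definition perfect_matching :: "'a set \<Rightarrow> 'a set set \<Rightarrow> 'a set set \<Rightarrow> bool" where
  "perfect_matching V E M \<longleftrightarrow> M \<subseteq> E \<and> (\<forall>v\<in>V. \<exists>!e. e \<in> M \<and> v \<in> e)"

text \<open>The graph without vertices has the empty perfect matching, so Hamiltonian cycles are central.\<close>

definition central_cycle :: "'a set \<Rightarrow> 'a set set \<Rightarrow> 'a list \<Rightarrow> bool" where
  "central_cycle V E C \<longleftrightarrow>
     is_cycle V E C \<and> (\<exists>M. perfect_matching (V - set C) (induced_edges E (V - set C)) M)"

definition orientation :: "'a set set \<Rightarrow> ('a \<times> 'a) set \<Rightarrow> bool" where
  "orientation E D \<longleftrightarrow>
     (\<forall>(u, v)\<in>D. {u, v} \<in> E) \<and>
     (\<forall>u v. {u, v} \<in> E \<longrightarrow> ((u, v) \<in> D \<longleftrightarrow> (v, u) \<notin> D))"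

definition pfaffian_orientation :: "'a set \<Rightarrow> 'a set set \<Rightarrow> ('a \<times> 'a) set \<Rightarrow> bool" where
  "pfaffian_orientation V E D \<longleftrightarrow>
     orientation E D \<and>
     (\<forall>C. central_cycle V E C \<longrightarrow>
        odd (card (cycle_arcs C \<inter> D)) \<and> odd (card (cycle_arcs (rev C) \<inter> D)))"

definition pfaffian :: "'a set \<Rightarrow> 'a set set \<Rightarrow> bool" where
  "pfaffian V E \<longleftrightarrow> (\<exists>D. pfaffian_orientation V E D)"

text \<open>In the following the anchor is the edge \<open>e = {s, t}\<close>, and paths are enumerated starting at \<open>t\<close>.\<close>

definition anchored_path :: "'a set \<Rightarrow> 'a set set \<Rightarrow> 'a \<Rightarrow> 'a \<Rightarrow> 'a list \<Rightarrow> bool" where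
  "anchored_path V E s t Q \<longleftrightarrow> hamiltonian_path V E Q \<and> (\<exists>R. Q = t # s # R)"

definition start_path :: "'a set \<Rightarrow> 'a set set \<Rightarrow> 'a list \<Rightarrow> 'a \<Rightarrow> 'a \<Rightarrow> 'a list \<Rightarrow> bool" where
  "start_path V E H s t Q \<longleftrightarrow>
     anchored_path V E s t Q \<and>
     (\<exists>u. u \<noteq> s \<and> {t, u} \<in> cycle_edges H \<and> last Q = u \<and> path_edges Q = cycle_edges H - {{t, u}})"

text \<open>The lollipop has the edge set \<open>insert {last Q, x} (path_edges Q)\<close>; the new path is the lollipop
  without the edge \<open>{v, x}\<close>.\<close>

definition lollipop_step :: "'a set \<Rightarrow> 'a set set \<Rightarrow> 'a \<Rightarrow> 'a \<Rightarrow> 'a list \<Rightarrow> 'a list \<Rightarrow> bool" where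
  "lollipop_step V E s t Q Q' \<longleftrightarrow>
     anchored_path V E s t Q \<and> anchored_path V E s t Q' \<and>
     (\<exists>x v. x \<noteq> t \<and> {last Q, x} \<in> E \<and> {last Q, x} \<notin> path_edges Q \<and>
        v \<notin> {last Q, t} \<and> {v, x} \<in> insert {last Q, x} (path_edges Q) \<and>
        path_edges Q' = insert {last Q, x} (path_edges Q) - {{v, x}} \<and> last Q' = v)"

text \<open>A (possibly unfinished) run of the method is the list \<open>[Q\<^sub>0, \<dots>, Q\<^sub>k]\<close> of the paths produced by its
  first \<open>k\<close> steps. The initial path \<open>Q\<^sub>0\<close> is exempt from the stopping test, as its last vertex is
  always a neighbour of \<open>t\<close>.\<close>

definition lollipop_run ::
  "'a set \<Rightarrow> 'a set set \<Rightarrow> 'a list \<Rightarrow> 'a \<Rightarrow> 'a \<Rightarrow> 'a list list \<Rightarrow> bool" where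
  "lollipop_run V E H s t Qs \<longleftrightarrow>
     Qs \<noteq> [] \<and> start_path V E H s t (Qs ! 0) \<and>
     (\<forall>i. Suc i < length Qs \<longrightarrow> lollipop_step V E s t (Qs ! i) (Qs ! Suc i)) \<and>
     (\<forall>i\<ge>1. Suc i < length Qs \<longrightarrow>
        Qs ! Suc i \<noteq> Qs ! (i - 1) \<and> {last (Qs ! i), t} \<notin> E)"

definition steps :: "'a list list \<Rightarrow> nat" where
  "steps Qs = length Qs - 1"

definition terminated :: "'a set set \<Rightarrow> 'a \<Rightarrow> 'a list list \<Rightarrow> bool" where
  "terminated E t Qs \<longleftrightarrow> steps Qs \<ge> 1 \<and> {last (last Qs), t} \<in> E"

text \<open>The method can start, never makes more than \<open>k\<close> steps, and never gets stuck: from every stage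
  of a run it reaches a path at which it terminates.\<close>

definition lollipop_terminates_within ::
  "'a set \<Rightarrow> 'a set set \<Rightarrow> 'a list \<Rightarrow> 'a \<Rightarrow> 'a \<Rightarrow> nat \<Rightarrow> bool" where
  "lollipop_terminates_within V E H s t k \<longleftrightarrow>
     (\<exists>Qs. lollipop_run V E H s t Qs) \<and>
     (\<forall>Qs. lollipop_run V E H s t Qs \<longrightarrow>
        steps Qs \<le> k \<and>
        (\<exists>Rs. lollipop_run V E H s t (Qs @ Rs) \<and> terminated E t (Qs @ Rs)))"

end

theory Submission
  imports Defs
begin

text \<open>Let \<open>A\<close> be the colour class of \<open>t\<close>. Every path of the method ends in \<open>B\<close>, and a step reverses the tail of
  the path behind a vertex \<open>x \<in> A\<close>, thereby replacing the edge \<open>vx\<close> behind \<open>x\<close> by the edge \<open>ux\<close> from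
  the end \<open>u\<close>. Regard a Pfaffian orientation as a sign for each edge. After switching the signs at some
  vertices of \<open>B\<close>, the two edges of the initial path at each \<open>x \<in> A - {t}\<close> have different signs. As the
  cycle of a lollipop is central, the Pfaffian property gives \<open>ux\<close> and \<open>vx\<close> the same sign, so this
  alternation persists along the run. Hence of the three edges at \<open>x\<close> the one whose sign is in the minority
  belongs to all paths, and every step at \<open>x\<close> moves the end between the same two vertices \<open>u\<close>, \<open>v\<close>.

  The successive ends therefore form a walk on \<open>B\<close>. At an end that is not a neighbour of \<open>t\<close> exactly
  two edges are outside the path, one of which was removed by the last step, so the continuation is
  forced. When the walk first returns to an earlier vertex, it has to retrace its steps to the initial end, which is a neighbour of \<open>t\<close>.
  This gives at most \<open>2 |B| = n\<close> steps.\<close>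

subsection \<open>Edges of paths and cycles\<close>

lemma path_edges_Nil [simp]: "path_edges [] = {}"
  and path_edges_single [simp]: "path_edges [a] = {}"
  and path_edges_Cons [simp]: "path_edges (a # b # L) = insert {a, b} (path_edges (b # L))"
  by (simp_all add: path_edges_def path_arcs_def)

lemma path_edges_subset_Pow: "path_edges L \<subseteq> Pow (set L)"
  by (induction L rule: induct_list012) auto

lemma path_edges_subsetD: "e \<in> path_edges L \<Longrightarrow> v \<in> e \<Longrightarrow> v \<in> set L"
  using path_edges_subset_Pow by blast

lemma path_edges_append: "path_edges (K @ a # L) = path_edges (K @ [a]) \<union> path_edges (a # L)"
  by (induction K rule: induct_list012) auto

lemma path_edges_snoc: "path_edges (L @ [a, b]) = insert {a, b} (path_edges (L @ [a]))"
  by (subst path_edges_append) auto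

lemma path_edges_rev [simp]: "path_edges (rev L) = path_edges L"
proof (induction L rule: induct_list012)
  case (3 a b L)
  have "path_edges (rev (a # b # L)) = insert {b, a} (path_edges (rev (b # L)))"
    using path_edges_snoc[of "rev L" b a] by simp
  with 3 show ?case by (auto simp: insert_commute)
qed auto

lemma path_edges_Cons_ne: "L \<noteq> [] \<Longrightarrow> path_edges (a # L) = insert {a, hd L} (path_edges L)"
  by (cases L) auto

lemma path_edges_split:
  assumes "K \<noteq> []" "L \<noteq> []"
  shows "path_edges (K @ L) = insert {last K, hd L} (path_edges K \<union> path_edges L)"
proof -
  have "K @ L = butlast K @ last K # L" using assms by simp
  then have "path_edges (K @ L) = path_edges K \<union> path_edges (last K # L)"
    using path_edges_append[of "butlast K" "last K" L] assms by (metis append_butlast_last_id)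
  then show ?thesis using assms by (auto simp: path_edges_Cons_ne)
qed

text \<open>Only the first edge contains the first vertex, so the list can be recovered edge by
  edge. This turns the edge-set equations in the definition of a lollipop step into equalities of
  lists.\<close>

lemma path_edges_inject:
  assumes "distinct K" "distinct L" "K \<noteq> []" "L \<noteq> []" "hd K = hd L" "path_edges K = path_edges L"
  shows "K = L"
  using assms
proof (induction K arbitrary: L rule: induct_list012)
  case (2 a)
  then show ?case by (cases L; cases "tl L") auto
next
  case (3 a b K)
  then obtain L' where L: "L = a # L'" by (cases L) auto
  have aK: "{a, c} \<notin> path_edges (b # K)" for c
    using 3(3) path_edges_subsetD[of "{a, c}" "b # K" a] by auto
  have aL: "{a, c} \<notin> path_edges L'" for c
    using 3(4) L path_edges_subsetD[of "{a, c}" L' a] by auto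
  have ne: "L' \<noteq> []" using 3(8) L by auto
  have eq: "insert {a, b} (path_edges (b # K)) = insert {a, hd L'} (path_edges L')"
    using 3(8) L ne by (simp add: path_edges_Cons_ne)
  then have "{a, b} = {a, hd L'}" using aL by blast
  then have b: "b = hd L'" by (metis doubleton_eq_iff)
  then have "path_edges (b # K) = path_edges L'"
    using eq aK[of b] aL[of b] by (simp add: insert_ident)
  then have "b # K = L'" using 3(2)[of L'] 3(3,4) L ne b by auto
  then show ?case using L by simp
qed auto

text \<open>Connectedness of a path, in the form that excludes deletions which would disconnect a
  lollipop.\<close>

lemma path_crosses:
  assumes "a \<in> set L" "a \<in> S" "b \<in> set L" "b \<notin> S"
  shows "\<exists>p q. {p, q} \<in> path_edges L \<and> p \<in> S \<and> q \<notin> S"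
  using assms
proof (induction L arbitrary: a b rule: induct_list012)
  case (3 c d L)
  show ?case
  proof (cases "c \<in> S \<longleftrightarrow> d \<in> S")
    case True
    then obtain a' b' where "a' \<in> set (d # L)" "a' \<in> S" "b' \<in> set (d # L)" "b' \<notin> S"
      using 3 by (metis list.set_intros(1) set_ConsD)
    from "3.IH"(2)[OF this] show ?thesis by auto
  next
    case False
    then show ?thesis by (metis insert_commute insertI1 path_edges_Cons)
  qed
qed auto

lemma path_edges_mid:
  assumes "distinct (P @ x # W)" "P \<noteq> []" "W \<noteq> []"
  shows "{c, x} \<in> path_edges (P @ x # W) \<longleftrightarrow> c = last P \<or> c = hd W"
proof -
  have "path_edges (P @ x # W) = insert {last P, x} (insert {x, hd W} (path_edges P \<union> path_edges W))"
    using assms by (auto simp: path_edges_split path_edges_Cons_ne)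
  moreover have "{c, x} \<notin> path_edges P" "{c, x} \<notin> path_edges W"
    using assms path_edges_subsetD[of "{c, x}" _ x] by auto
  ultimately show ?thesis by (auto simp: doubleton_eq_iff)
qed

lemma path_edges_last:
  assumes "distinct (L @ [a, b])"
  shows "{c, b} \<in> path_edges (L @ [a, b]) \<longleftrightarrow> c = a"
  using assms path_edges_subsetD[of "{c, b}" "L @ [a]" b]
  by (auto simp: path_edges_snoc doubleton_eq_iff)

text \<open>Reversal keeps the inner edges of \<open>W\<close> and changes only the edge that
  attaches it to \<open>x\<close>.\<close>

lemma path_edges_reverse_tail:
  assumes "distinct (P @ x # W)" "P \<noteq> []" "length W \<ge> 2"
  shows "path_edges (P @ x # rev W) =
    insert {last W, x} (path_edges (P @ x # W)) - {{hd W, x}}"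
proof -
  have W: "W \<noteq> []" "last W \<noteq> hd W"
    using assms by (cases W; cases "tl W"; auto)+
  have "path_edges (P @ x # W) = insert {last P, x} (insert {x, hd W} (path_edges P \<union> path_edges W))"
    "path_edges (P @ x # rev W) = insert {last P, x} (insert {x, last W} (path_edges P \<union> path_edges W))"
    using assms W by (auto simp: path_edges_split path_edges_Cons_ne hd_rev)
  moreover have "{hd W, x} \<notin> path_edges P" "{hd W, x} \<notin> path_edges W"
    using assms path_edges_subsetD[of "{hd W, x}" _ x] by auto
  moreover have "hd W \<noteq> last P"
    using assms(1) hd_in_set[OF W(1)] last_in_set[OF assms(2)] by (auto simp del: hd_in_set last_in_set)
  ultimately show ?thesis using W by (auto simp: doubleton_eq_iff insert_commute)
qed

section \<open>Parity of the number of arcs of a walk that agree with an orientation\<close>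

fun walk_parity :: "('a \<times> 'a) set \<Rightarrow> 'a list \<Rightarrow> bool" where
  "walk_parity D (a # b # L) \<longleftrightarrow> ((a, b) \<in> D) \<noteq> walk_parity D (b # L)"
| "walk_parity D L \<longleftrightarrow> False"

lemma walk_parity_snoc:
  "L \<noteq> [] \<Longrightarrow> walk_parity D (L @ [c]) \<longleftrightarrow> walk_parity D L \<noteq> ((last L, c) \<in> D)"
  by (induction L rule: induct_list012) auto

text \<open>The arcs of the cycle have distinct tails, so none is counted twice and the cardinality
  follows the recursion of \<open>walk_parity\<close>.\<close>

lemma odd_cycle_arcs_iff:
  assumes "distinct (x # L)"
  shows "odd (card (cycle_arcs (x # L) \<inter> D)) \<longleftrightarrow> walk_parity D (x # L @ [x])"
proof -
  \<comment> \<open>The closing vertex is generalised to \<open>z\<close>, since the induction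
    changes the first vertex.\<close>
  have "odd (card (set (zip (x # L) (L @ [z])) \<inter> D)) \<longleftrightarrow> walk_parity D (x # L @ [z])" for z
    using assms
  proof (induction L arbitrary: x)
    case (Cons a L)
    have "(x, a) \<notin> set (zip (a # L) (L @ [z]))"
      using Cons.prems by (auto dest: set_zip_leftD)
    with Cons show ?case by (auto simp: Int_insert_left)
  qed (auto simp: Int_insert_left)
  then show ?thesis by (simp add: cycle_arcs_def)
qed

lemma cycle_edges_Cons: "cycle_edges (x # L) = path_edges (x # L @ [x])"
proof -
  have "set (zip (x # L) (L @ [z])) = set (zip (x # L @ [z]) (L @ [z]))" for z
    by (induction L arbitrary: x) auto
  then show ?thesis by (simp add: cycle_edges_def path_edges_def cycle_arcs_def path_arcs_def)
qed

text \<open>Cuts the cycle open at \<open>t\<close>, so that the lemmas on paths apply to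
  it.\<close>

lemma cycle_edges_rotate:
  assumes "t \<in> set H"
  obtains L where "cycle_edges H = path_edges (t # L @ [t])" "set H = insert t (set L)"
    "length H = Suc (length L)" "distinct H \<longleftrightarrow> distinct (t # L)"
proof -
  obtain K M where H: "H = K @ t # M" using assms split_list by metis
  show ?thesis
  proof (cases K)
    case Nil
    then show ?thesis using H that[of M] by (simp add: cycle_edges_Cons)
  next
    case (Cons h K')
    have "cycle_edges H = path_edges ((h # K') @ t # (M @ [h]))"
      using H Cons by (simp add: cycle_edges_Cons)
    also have "\<dots> = path_edges (h # K' @ [t]) \<union> path_edges ((t # M) @ [h])"
      by (subst path_edges_append) simp
    also have "\<dots> = path_edges ((t # M) @ h # K' @ [t])"
      using path_edges_append[of "t # M" h "K' @ [t]"] by auto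
    finally show ?thesis using H Cons that[of "M @ h # K'"] by auto
  qed
qed

subsection \<open>Retracing walks\<close>

text \<open>\<open>free i b x\<close> says that the edge between \<open>b\<close> and \<open>x\<close> is unused at time \<open>i\<close>; the walk moves from
  \<open>y i\<close> to \<open>y (Suc i)\<close> through \<open>X i\<close>. When it first returns to a vertex \<open>y i\<close>, the only free
  edge other than the one just released is the one through which \<open>y i\<close> was first entered, so the
  walk retraces its way back to \<open>y 0\<close>.\<close>

lemma retracing_walk_bound:
  fixes y X :: "nat \<Rightarrow> 'a" and free :: "nat \<Rightarrow> 'a \<Rightarrow> 'a \<Rightarrow> bool"
  assumes B: "\<And>i. i \<le> h \<Longrightarrow> y i \<in> B" "finite B" "card B \<le> m"
    and arrive: "\<And>i. i < h \<Longrightarrow> free (Suc i) (y (Suc i)) (X i)"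
    and used: "\<And>i. i < h \<Longrightarrow> \<not> free i (y (Suc i)) (X i)"
    and keep: "\<And>i b x. i < h \<Longrightarrow> free i b x \<Longrightarrow> \<not> free (Suc i) b x \<Longrightarrow> b \<in> B \<Longrightarrow> b = y i \<and> x = X i"
    and noback: "\<And>i. Suc i < h \<Longrightarrow> X (Suc i) \<noteq> X i"
    and two: "\<And>i z. Suc i < h \<Longrightarrow> free (Suc i) (y (Suc i)) z \<Longrightarrow> z = X i \<or> z = X (Suc i)"
    and pair: "\<And>i j. i < h \<Longrightarrow> j < h \<Longrightarrow> X i = X j \<Longrightarrow> {y i, y (Suc i)} = {y j, y (Suc j)}"
    and avoid: "\<And>i. 0 < i \<Longrightarrow> i < h \<Longrightarrow> y i \<noteq> y 0"
  shows "h \<le> 2 * m"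
proof (rule ccontr)
  assume "\<not> h \<le> 2 * m"
  then have h: "2 * m < h" by simp
  \<comment> \<open>Pigeonhole: the \<open>m + 1\<close> times up to \<open>m\<close> cannot all
    have different values in \<open>B\<close>.\<close>
  have "\<not> inj_on y {..m}"
  proof
    assume "inj_on y {..m}"
    moreover have "y ` {..m} \<subseteq> B" using B(1) h by auto
    ultimately show False using card_inj_on_le[of y "{..m}" B] B(2,3) by simp
  qed
  then have ex: "\<exists>k. k \<le> m \<and> (\<exists>i<k. y i = y k)"
    unfolding inj_on_def by (metis atMost_iff nat_neq_iff)
  \<comment> \<open>The time of the first return; before it, \<open>y\<close> is injective.\<close>
  define k where "k = (LEAST k. k \<le> m \<and> (\<exists>i<k. y i = y k))"
  have k: "k \<le> m" "\<exists>i<k. y i = y k" using LeastI_ex[OF ex] unfolding k_def by auto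
  then obtain i where i: "i < k" "y i = y k" by blast
  have "y a \<noteq> y b" if "b < k" "a < b" for a b
    using not_less_Least[of b "\<lambda>k. k \<le> m \<and> (\<exists>i<k. y i = y k)"] that k unfolding k_def[symmetric] by auto
  then have inj: "a = b" if "a < k" "b < k" "y a = y b" for a b
    using that by (metis nat_neq_iff)
  have ki: "k + i < h" using i k h by simp
  have "y (k + r) = y (i - r)" if "r \<le> i" for r
    using that
  proof (induction r rule: less_induct)
    case (less r)
    show ?case
    proof (cases r)
      case 0
      then show ?thesis using i by simp
    next
      case (Suc q)
      define a where "a = i - q"
      then obtain a' where a': "a = Suc a'" using Suc less.prems not0_implies_Suc[of a] by auto
      have ya: "y (k + q) = y a" using less.IH[of q] Suc less.prems a_def by simp
      have kq: "k + q < h" using ki Suc less.prems by simp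
      have ak: "a < k" using a_def i by simp
      \<comment> \<open>The edge by which the walk entered \<open>y a\<close> stays free: losing it
        at time \<open>c\<close> means leaving \<open>y a\<close> through it. For
        \<open>c < k\<close> injectivity forces \<open>c = a\<close>, an immediate reversal; for
        \<open>c = k + p\<close> the retracing so far forces \<open>p = q\<close>, which is too
        late.\<close>
      have free: "free c (y a) (X a')" if "a \<le> c" "c \<le> k + q" for c
        using that
      proof (induction c rule: dec_induct)
        case base
        then show ?case using arrive[of a'] a' ak kq by simp
      next
        case (step c)
        show ?case
        proof (rule ccontr)
          assume "\<not> ?case"
          then have c: "y a = y c" "X a' = X c"
            using keep[of c "y a" "X a'"] step B(1)[of a] ak kq by auto
          show False
          proof (cases "c < k")
            case True
            then have "c = a" using inj[of a c] c ak by simp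
            then show False using c noback[of a'] a' ak kq by auto
          next
            case False
            then obtain p where p: "c = k + p" using le_Suc_ex by (metis not_less)
            then have "y a = y (i - p)" using less.IH[of p] c step Suc less.prems by auto
            then have "a = i - p" using inj[of a "i - p"] ak i by simp
            then show False using p step a_def Suc less.prems by simp
          qed
        qed
      qed
      obtain l where l: "k + q = Suc l" using i by (cases "k + q") auto
      \<comment> \<open>The edge just released was in use at time \<open>l\<close>, whereas the
        entry edge was free then. So they differ, and \<open>two\<close> forces the walk out through
        the entry edge.\<close>
      have "X a' \<noteq> X l" using used[of l] free[of l] ya l ak kq by auto
      then have "X a' = X (k + q)" using two[of l "X a'"] free[of "k + q"] l ya ak kq by auto
      then have "{y a', y a} = {y a, y (Suc (k + q))}"
        using pair[of a' "k + q"] a' ak kq ya by simp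
      moreover have "a' = i - r" using a' a_def Suc by simp
      moreover have "y a' \<noteq> y a" using inj[of a' a] ak a' by auto
      ultimately show ?thesis using Suc by (auto simp: doubleton_eq_iff)
    qed
  qed
  from this[of i] have "y (k + i) = y 0" by simp
  then show False using avoid[of "k + i"] i ki by simp
qed

subsection \<open>Lollipop steps in cubic bipartite graphs\<close>

lemma reverse_tail_twice:
  assumes "distinct (P @ x # W)" "P @ x # rev W = P' @ x # W'"
  shows "P' @ x # rev W' = P @ x # W"
proof -
  have "x \<notin> set P" "x \<notin> set (rev W)" using assms(1) by auto
  then have "P = P' \<and> rev W = W'" using assms(2) append_Cons_eq_iff by metis
  then show ?thesis by auto
qed

locale cubic_bipartite =
  fixes V :: "'a set" and E :: "'a set set" and A B :: "'a set" and s t :: 'a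
  assumes simple: "simple_graph V E" and cubic: "cubic V E"
    and sides: "A \<union> B = V" "A \<inter> B = {}"
    and edge: "e \<in> E \<Longrightarrow> \<exists>a\<in>A. \<exists>b\<in>B. e = {a, b}"
    and t: "t \<in> A"
begin

abbreviation anchored :: "'a list \<Rightarrow> bool" where
  "anchored \<equiv> anchored_path V E s t"

text \<open>A lollipop step in list form: the end is joined to \<open>x\<close> and the tail behind
  \<open>x\<close> is run through the other way. For an anchored path, \<open>P \<noteq> []\<close>
  keeps \<open>x\<close> different from \<open>t\<close>, and \<open>2 \<le> length W\<close> makes
  the new edge differ from the last edge of the path.\<close>

definition turn :: "'a list \<Rightarrow> 'a \<Rightarrow> 'a list \<Rightarrow> bool" where
  "turn Q x Q' \<longleftrightarrow> (\<exists>P W. Q = P @ x # W \<and> Q' = P @ x # rev W \<and> P \<noteq> [] \<and> 2 \<le> length W \<and>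
     {last W, x} \<in> E)"

lemma edge_sides: "{u, v} \<in> E \<Longrightarrow> u \<in> A \<and> v \<in> B \<or> u \<in> B \<and> v \<in> A"
  using edge[of "{u, v}"] by (auto simp: doubleton_eq_iff)

lemma not_both_sides: "v \<in> A \<Longrightarrow> v \<in> B \<Longrightarrow> False"
  using sides by auto

lemma edge_in_V: "{u, v} \<in> E \<Longrightarrow> u \<in> V \<and> v \<in> V \<and> u \<noteq> v"
  using edge_sides[of u v] sides by auto

lemma incident_edges:
  assumes "v \<in> V"
  shows "card {e \<in> E. v \<in> e} = 3" "finite {e \<in> E. v \<in> e}"
proof -
  show "card {e \<in> E. v \<in> e} = 3" using cubic assms by (simp add: cubic_def)
  then show "finite {e \<in> E. v \<in> e}" by (metis card.infinite zero_neq_numeral)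
qed

lemma three_neighbors:
  assumes "{w, v} \<in> E" "{x, v} \<in> E" "{y, v} \<in> E" "w \<noteq> x" "w \<noteq> y" "x \<noteq> y" "{z, v} \<in> E"
  shows "z = w \<or> z = x \<or> z = y"
proof -
  have v: "v \<in> V" using assms edge_in_V by blast
  have "{{w, v}, {x, v}, {y, v}} = {e \<in> E. v \<in> e}"
  proof (rule card_subset_eq)
    show "card {{w, v}, {x, v}, {y, v}} = card {e \<in> E. v \<in> e}"
      using assms(4-6) assms(1-3)[THEN edge_in_V] incident_edges[OF v] by (simp add: card_insert_if doubleton_eq_iff)
  qed (use assms incident_edges[OF v] in auto)
  then have "{z, v} \<in> {{w, v}, {x, v}, {y, v}}" using assms by auto
  then show ?thesis by (auto simp: doubleton_eq_iff)
qed

lemma two_other_neighbors: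
  assumes "{p, v} \<in> E"
  obtains x y where "{x, v} \<in> E" "{y, v} \<in> E" "x \<noteq> y" "x \<noteq> p" "y \<noteq> p"
proof -
  have v: "v \<in> V" using assms edge_in_V by blast
  have "card ({e \<in> E. v \<in> e} - {{p, v}}) = 2"
    using incident_edges[OF v] assms by simp
  then obtain d e where de: "{e \<in> E. v \<in> e} - {{p, v}} = {d, e}" "d \<noteq> e"
    by (auto simp: card_2_iff)
  have "\<exists>x. f = {x, v}" if "f \<in> E" "v \<in> f" for f using edge[OF that(1)] that(2) by auto
  then obtain x y where "d = {x, v}" "e = {y, v}"
    using de by (metis (no_types, lifting) DiffE insertI1 insertI2 mem_Collect_eq)
  moreover have "d \<in> E" "e \<in> E" "d \<noteq> {p, v}" "e \<noteq> {p, v}" using de by blast+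
  ultimately show ?thesis using that[of x y] de(2) by auto
qed

lemma anchoredD:
  assumes "anchored Q"
  shows "distinct Q" "set Q = V" "path_edges Q \<subseteq> E" "hd Q = t" "Q \<noteq> []" "s \<in> B"
  using assms edge_sides[of t s] t not_both_sides[of t]
  by (auto simp: anchored_path_def hamiltonian_path_def)

lemma turnD:
  assumes Q: "anchored Q" "last Q \<in> B" and "turn Q x Q'"
  shows "anchored Q'" "last Q' \<in> B" "x \<in> A" "x \<noteq> t" "{last Q, x} \<in> E"
    "{last Q, x} \<notin> path_edges Q" "{last Q', x} \<in> path_edges Q" "last Q \<noteq> last Q'"
    "path_edges Q' = insert {last Q, x} (path_edges Q) - {{last Q', x}}"
    "\<exists>z. z \<noteq> last Q' \<and> {z, x} \<in> path_edges Q"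
proof -
  obtain P W where PW: "Q = P @ x # W" "Q' = P @ x # rev W" "P \<noteq> []" "2 \<le> length W" "{last W, x} \<in> E"
    using assms(3) unfolding turn_def by blast
  note a = anchoredD[OF Q(1)]
  have W: "W \<noteq> []" "last W \<noteq> hd W" using PW a(1) by (cases W; cases "tl W"; auto)+
  have l: "last Q = last W" "last Q' = hd W" using PW W by (auto simp: last_rev)
  have P: "last P \<noteq> hd W" "last P \<noteq> last W"
    using a(1) PW hd_in_set[OF W(1)] last_in_set[OF W(1)] last_in_set[OF PW(3)]
    by (auto simp del: hd_in_set last_in_set)
  have mid: "{c, x} \<in> path_edges Q \<longleftrightarrow> c = last P \<or> c = hd W" for c
    using path_edges_mid[of P x W] PW a W by simp
  show x: "x \<in> A" using PW(5) Q(2) l edge_sides[of "last W" x] not_both_sides by auto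
  show xt: "x \<noteq> t" using a PW by (cases P) auto
  show "{last Q, x} \<in> E" using PW l by simp
  show "{last Q, x} \<notin> path_edges Q" using l mid P W by auto
  show v: "{last Q', x} \<in> path_edges Q" using l mid by simp
  then show "last Q' \<in> B" using a edge_sides[of "last Q'" x] x not_both_sides by blast
  show "last Q \<noteq> last Q'" using l W by simp
  show pe: "path_edges Q' = insert {last Q, x} (path_edges Q) - {{last Q', x}}"
    using path_edges_reverse_tail[of P x W] PW a l by simp
  show "\<exists>z. z \<noteq> last Q' \<and> {z, x} \<in> path_edges Q" using mid P l by auto
  obtain R where R: "Q = t # s # R" using Q(1) by (auto simp: anchored_path_def)
  \<comment> \<open>\<open>x\<close> lies in \<open>A\<close> and \<open>s\<close> in
    \<open>B\<close>, so \<open>x\<close> comes after \<open>s\<close> and the reversal spares the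
    anchor.\<close>
  have "\<exists>R. P = t # s # R"
  proof (cases P)
    case (Cons c P')
    then show ?thesis using R PW x a(6) not_both_sides by (cases P') auto
  qed (use PW in simp)
  then have "\<exists>R. Q' = t # s # R" using PW by auto
  moreover have "path_edges Q' \<subseteq> E" using pe a PW l by auto
  moreover have "distinct Q'" "set Q' = V" using a PW by auto
  ultimately show "anchored Q'" by (auto simp: anchored_path_def hamiltonian_path_def)
qed

lemma turn_if_free:
  assumes "anchored Q" "{last Q, x} \<in> E" "{last Q, x} \<notin> path_edges Q" "x \<noteq> t"
  obtains Q' where "turn Q x Q'"
proof -
  note a = anchoredD[OF assms(1)]
  have "x \<in> set Q" using assms a edge_in_V by auto
  then obtain P W where PW: "Q = P @ x # W" using split_list by metis
  have "W \<noteq> []" using PW assms(2) edge_in_V[of "last Q" x] by auto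
  moreover have "W \<noteq> [w]" for w
  proof
    assume "W = [w]"
    then show False using path_edges_append[of P x "[w]"] PW assms(3) by (auto simp: insert_commute)
  qed
  ultimately have "2 \<le> length W" by (cases W; cases "tl W") auto
  moreover have "P \<noteq> []" using PW a assms(4) by auto
  ultimately show ?thesis using that[of "P @ x # rev W"] PW assms(2) \<open>W \<noteq> []\<close> unfolding turn_def by auto
qed

text \<open>Two path edges meet \<open>x\<close>. Deleting the one on the stick would disconnect the
  lollipop, so the other one is deleted; start vertex and edge set then determine the new
  list.\<close>

lemma lollipop_step_iff_turn:
  assumes Q: "anchored Q" "last Q \<in> B"
  shows "lollipop_step V E s t Q Q' \<longleftrightarrow> (\<exists>x. turn Q x Q')"
proof
  assume "\<exists>x. turn Q x Q'"
  then obtain x where x: "turn Q x Q'" by blast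
  note T = turnD[OF Q x]
  show "lollipop_step V E s t Q Q'"
    unfolding lollipop_step_def
  proof (intro conjI exI)
    show "last Q' \<notin> {last Q, t}" using T(2,8) t not_both_sides[of t] by auto
  qed (use Q T in auto)
next
  assume "lollipop_step V E s t Q Q'"
  then obtain x v where Q': "anchored Q'" and x: "x \<noteq> t" "{last Q, x} \<in> E" "{last Q, x} \<notin> path_edges Q"
    and v: "v \<notin> {last Q, t}" "{v, x} \<in> insert {last Q, x} (path_edges Q)"
      "path_edges Q' = insert {last Q, x} (path_edges Q) - {{v, x}}" "last Q' = v"
    unfolding lollipop_step_def by - (elim conjE exE, rule that)
  obtain Q'' where Q'': "turn Q x Q''" using turn_if_free[OF Q(1) x(2,3,1)] by blast
  then obtain P W where PW: "Q = P @ x # W" "Q'' = P @ x # rev W" "P \<noteq> []" "2 \<le> length W"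
    unfolding turn_def by blast
  note T = turnD[OF Q Q'']
  note a = anchoredD[OF Q(1)] and a' = anchoredD[OF Q']
  have W: "W \<noteq> []" using PW(4) by auto
  have l: "last Q = last W" "last Q'' = hd W" using PW W by (auto simp: last_rev)
  have "{v, x} \<noteq> {last Q, x}" using v(1) by (auto simp: doubleton_eq_iff)
  then have "{v, x} \<in> path_edges Q" using v by auto
  then have v2: "v = last P \<or> v = hd W" using path_edges_mid[of P x W] PW a W by simp
  \<comment> \<open>Without this edge nothing joins \<open>P\<close> to the other vertices, but
    \<open>Q'\<close> has to cross between them.\<close>
  have "v \<noteq> last P"
  proof
    assume vP: "v = last P"
    have "t \<in> set P" using a PW by (cases P) auto
    moreover have "set P \<subseteq> set Q'" "x \<in> set Q'" "x \<notin> set P" using PW a a' by auto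
    ultimately obtain p q where pq: "{p, q} \<in> path_edges Q'" "p \<in> set P" "q \<notin> set P"
      using path_crosses[of t Q' "set P" x] by blast
    have "path_edges Q = insert {last P, x} (path_edges P \<union> path_edges (x # W))"
      using PW by (simp add: path_edges_split)
    moreover have "{p, q} \<notin> path_edges P" using path_edges_subsetD[of "{p, q}" P q] pq by auto
    moreover have "{p, q} \<notin> path_edges (x # W)"
      using path_edges_subsetD[of "{p, q}" "x # W" p] pq a(1) PW by auto
    moreover have "{p, q} \<noteq> {last Q, x}"
      using pq(2) l a(1) PW last_in_set[OF W] by (auto simp: doubleton_eq_iff simp del: last_in_set)
    ultimately show False using pq v(3) vP by auto
  qed
  then have "path_edges Q' = path_edges Q''" using v2 l T(9) v(3) by simp
  then have "Q' = Q''"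
    using path_edges_inject[of Q' Q''] a' anchoredD[OF T(1)] by simp
  then show "\<exists>x. turn Q x Q'" using Q'' by blast
qed

text \<open>Reversing the same tail twice is the identity. Hence a run, which never goes straight
  back, cannot use the same \<open>x\<close> in two successive steps.\<close>

lemma turn_back:
  assumes "anchored Q" "turn Q x Q'" "turn Q' x Q''"
  shows "Q'' = Q"
proof -
  obtain P W where PW: "Q = P @ x # W" "Q' = P @ x # rev W" using assms(2) unfolding turn_def by blast
  obtain P' W' where PW': "Q' = P' @ x # W'" "Q'' = P' @ x # rev W'" using assms(3) unfolding turn_def by blast
  show ?thesis using reverse_tail_twice[of P x W P' W'] PW PW' anchoredD(1)[OF assms(1)] by simp
qed

subsection \<open>Signs from a Pfaffian orientation\<close>

text \<open>The matching consists of every second edge, beginning with the first; ends in opposite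
  classes make the number of vertices even.\<close>

lemma even_path_matching:
  assumes "distinct P" "path_edges P \<subseteq> E" "P \<noteq> [] \<Longrightarrow> hd P \<in> A \<and> last P \<in> B"
  shows "\<exists>M. perfect_matching (set P) (induced_edges E (set P)) M"
  using assms
proof (induction P rule: induct_list012)
  case 1
  show ?case by (auto simp: perfect_matching_def)
next
  case (2 a)
  then show ?case using not_both_sides by auto
next
  case (3 a b L)
  have ab: "{a, b} \<in> E" "a \<in> A" using 3 by auto
  then have b: "b \<in> B" using edge_sides not_both_sides by blast
  have "hd L \<in> A \<and> last L \<in> B" if "L \<noteq> []"
    using 3(4,5) b that edge_sides[of b "hd L"] not_both_sides by (auto simp: path_edges_Cons_ne)
  moreover have "path_edges L \<subseteq> E" using 3(4) by (cases "L = []") (auto simp: path_edges_Cons_ne)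
  ultimately obtain M where M: "perfect_matching (set L) (induced_edges E (set L)) M"
    using 3(1,3) by auto
  then have sub: "M \<subseteq> E" "\<And>e v. e \<in> M \<Longrightarrow> v \<in> e \<Longrightarrow> v \<in> set L"
    by (auto simp: perfect_matching_def induced_edges_def)
  have "\<exists>!e. e \<in> insert {a, b} M \<and> v \<in> e" if "v \<in> set (a # b # L)" for v
  proof (cases "v \<in> set L")
    case True
    then have "v \<noteq> a" "v \<noteq> b" using 3(3) by auto
    moreover have "\<exists>!e. e \<in> M \<and> v \<in> e" using M True by (simp add: perfect_matching_def)
    ultimately show ?thesis by auto
  next
    case False
    then have "e \<in> M \<Longrightarrow> v \<notin> e" for e using sub by blast
    then show ?thesis using that False by (intro ex1I[of _ "{a, b}"]) auto
  qed
  then have "perfect_matching (set (a # b # L)) (induced_edges E (set (a # b # L))) (insert {a, b} M)"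
    using sub ab unfolding perfect_matching_def induced_edges_def by auto
  then show ?case by blast
qed

text \<open>The function \<open>\<epsilon>\<close> records the vertices of \<open>B\<close> at which the signs are switched.\<close>

definition sign :: "('a \<times> 'a) set \<Rightarrow> ('a \<Rightarrow> bool) \<Rightarrow> 'a \<Rightarrow> 'a \<Rightarrow> bool" where
  "sign D \<epsilon> b x \<longleftrightarrow> ((b, x) \<in> D) \<noteq> \<epsilon> b"

definition alternating :: "('a \<times> 'a) set \<Rightarrow> ('a \<Rightarrow> bool) \<Rightarrow> 'a list \<Rightarrow> bool" where
  "alternating D \<epsilon> Q \<longleftrightarrow> (\<forall>x b c. x \<in> A - {t} \<longrightarrow> {b, x} \<in> path_edges Q \<longrightarrow> {c, x} \<in> path_edges Q \<longrightarrow>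
     b \<noteq> c \<longrightarrow> sign D \<epsilon> b x \<noteq> sign D \<epsilon> c x)"

text \<open>The condition at a vertex of \<open>A\<close> links only the two neighbouring
  \<open>B\<close>-vertices on the path. So the switch at each \<open>B\<close>-vertex can be chosen
  from the switch at the next one without conflict.\<close>

lemma alternating_exists:
  assumes "anchored Q"
  obtains \<epsilon> where "alternating D \<epsilon> Q"
proof -
  \<comment> \<open>Two vertices are removed at a time, hence the statement for paths starting in
    \<open>B\<close>; it is applied below to \<open>Q\<close> without \<open>t\<close>.\<close>
  have *: "\<exists>\<epsilon>. \<forall>x b c. x \<in> A \<longrightarrow> {b, x} \<in> path_edges W \<longrightarrow> {c, x} \<in> path_edges W \<longrightarrow>
      b \<noteq> c \<longrightarrow> sign D \<epsilon> b x \<noteq> sign D \<epsilon> c x"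
    if "distinct W" "path_edges W \<subseteq> E" "W \<noteq> [] \<Longrightarrow> hd W \<in> B" for W
    using that
  proof (induction W rule: length_induct)
    case (1 W)
    consider "length W \<le> 1" | b w where "W = [b, w]" | b w b' R where "W = b # w # b' # R"
      by (cases W rule: remdups_adj.cases; cases "tl (tl W)") auto
    then show ?case
    proof cases
      case 1
      then show ?thesis by (cases W) auto
    next
      case 2
      then show ?thesis by (auto simp: doubleton_eq_iff)
    next
      case (3 b w b')
      have E: "{b, w} \<in> E" "{w, b'} \<in> E" "b \<in> B" "path_edges (b' # R) \<subseteq> E" and d: "distinct (b # w # b' # R)"
        using 3 1(2-4) by auto
      have wb: "w \<in> A" "b' \<in> B" using E edge_sides not_both_sides by blast+
      have "length (b' # R) < length W" "distinct (b' # R)" "hd (b' # R) \<in> B" using 3 d wb by auto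
      then obtain \<epsilon> where \<epsilon>: "\<And>x c c'. x \<in> A \<Longrightarrow> {c, x} \<in> path_edges (b' # R) \<Longrightarrow>
          {c', x} \<in> path_edges (b' # R) \<Longrightarrow> c \<noteq> c' \<Longrightarrow> sign D \<epsilon> c x \<noteq> sign D \<epsilon> c' x"
        using 1(1)[rule_format, of "b' # R"] E(4) by blast
      \<comment> \<open>As \<open>b\<close> does not occur later on the path, its switch is free to
        make the signs at \<open>w\<close> differ.\<close>
      define \<delta> where "\<delta> = \<epsilon>(b := (((b, w) \<in> D) = sign D \<epsilon> b' w))"
      have s: "sign D \<delta> c x = sign D \<epsilon> c x" if "c \<noteq> b" for c x
        using that by (simp add: sign_def \<delta>_def)
      have sb: "sign D \<delta> b w \<noteq> sign D \<delta> b' w"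
        using s[of b' w] d by (auto simp: sign_def \<delta>_def)
      have R: "c \<noteq> b \<and> x \<noteq> w" if "{c, x} \<in> path_edges (b' # R)" for c x
        using path_edges_subsetD[OF that] d by auto
      have "sign D \<delta> c x \<noteq> sign D \<delta> c' x"
        if x: "x \<in> A" and c: "{c, x} \<in> path_edges W" "{c', x} \<in> path_edges W" "c \<noteq> c'" for x c c'
      proof (cases "x = w")
        case True
        then have "c \<in> {b, b'}" "c' \<in> {b, b'}"
          using c R[of c x] R[of c' x] 3 by (auto simp: doubleton_eq_iff)
        then show ?thesis using sb True c(3) by auto
      next
        case False
        then have "{c, x} \<in> path_edges (b' # R)" "{c', x} \<in> path_edges (b' # R)"
          using c 3 x E wb not_both_sides[of x] by (auto simp: doubleton_eq_iff)
        then show ?thesis using \<epsilon>[OF x] s R c by metis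
      qed
      then show ?thesis by blast
    qed
  qed
  obtain R where R: "Q = t # s # R" using assms by (auto simp: anchored_path_def)
  note a = anchoredD[OF assms]
  obtain \<epsilon> where \<epsilon>: "\<And>x c c'. x \<in> A \<Longrightarrow> {c, x} \<in> path_edges (s # R) \<Longrightarrow> {c', x} \<in> path_edges (s # R) \<Longrightarrow>
          c \<noteq> c' \<Longrightarrow> sign D \<epsilon> c x \<noteq> sign D \<epsilon> c' x"
    using *[of "s # R"] a R by auto
  have "{c, x} \<in> path_edges (s # R)" if "{c, x} \<in> path_edges Q" "x \<in> A - {t}" for c x
    using that R a(6) not_both_sides[of x] by (auto simp: doubleton_eq_iff)
  then show ?thesis using that \<epsilon> unfolding alternating_def by (metis DiffD1)
qed

text \<open>For consecutive \<open>b\<close>, \<open>w\<close>, \<open>b'\<close>, reversing the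
  second arc and using the sign change at \<open>w\<close> gives the two arcs together the parity
  \<open>\<epsilon> b \<noteq> \<epsilon> b'\<close>. These terms telescope along
  \<open>W\<close>.\<close>

lemma walk_parity_alternating:
  assumes D: "orientation E D" and "alternating D \<epsilon> Q" "path_edges Q \<subseteq> E"
    and "W \<noteq> []" "distinct W" "path_edges W \<subseteq> path_edges Q" "hd W \<in> B" "last W \<in> B" "t \<notin> set W"
  shows "walk_parity D W \<longleftrightarrow> \<epsilon> (hd W) \<noteq> \<epsilon> (last W)"
  using assms(4-)
proof (induction W rule: length_induct)
  case (1 W)
  consider w where "W = [w]" | b w where "W = [b, w]" | b w b' R where "W = b # w # b' # R"
    using 1(2) by (cases W rule: remdups_adj.cases; cases "tl (tl W)") auto
  then show ?case
  proof cases
    case 1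
    then show ?thesis by simp
  next
    case 2
    then show ?thesis using "1.prems" assms(3) edge_sides[of b w] not_both_sides by auto
  next
    case (3 b w b')
    have E: "{b, w} \<in> path_edges Q" "{b', w} \<in> path_edges Q" "b \<in> B"
      using 3 "1.prems" by (auto simp: insert_commute)
    then have wb: "w \<in> A" "b' \<in> B" using assms(3) edge_sides not_both_sides by blast+
    have "walk_parity D (b' # R) \<longleftrightarrow> \<epsilon> b' \<noteq> \<epsilon> (last W)"
      using 1(1)[rule_format, of "b' # R"] "1.prems" 3 wb by auto
    moreover have "sign D \<epsilon> b w \<noteq> sign D \<epsilon> b' w"
      using assms(2) E wb "1.prems" 3 unfolding alternating_def by auto
    moreover have "(w, b') \<in> D \<longleftrightarrow> (b', w) \<notin> D"
      using D E assms(3) unfolding orientation_def by (metis subsetD insert_commute)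
    ultimately show ?thesis using 3 by (auto simp: sign_def)
  qed
qed

text \<open>The cycle of a lollipop is central, since the stick without its junction vertex is a path with
  an even number of vertices.\<close>

lemma turn_sign:
  assumes D: "pfaffian_orientation V E D" and alt: "alternating D \<epsilon> Q"
    and Q: "anchored Q" "last Q \<in> B" and turn: "turn Q x Q'"
  shows "sign D \<epsilon> (last Q) x = sign D \<epsilon> (last Q') x"
proof -
  obtain P W where PW: "Q = P @ x # W" "Q' = P @ x # rev W" "P \<noteq> []" "2 \<le> length W" "{last W, x} \<in> E"
    using turn unfolding turn_def by blast
  note a = anchoredD[OF Q(1)] and T = turnD[OF Q turn]
  have W: "W \<noteq> []" using PW(4) by auto
  have l: "last Q = last W" "last Q' = hd W" using PW W by (auto simp: last_rev)
  have pe: "path_edges Q = insert {last P, x} (insert {x, hd W} (path_edges P \<union> path_edges W))"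
    using PW W by (auto simp: path_edges_split path_edges_Cons_ne)
  have "t \<in> set P" using a PW by (cases P) auto
  then have tW: "t \<notin> set W" using a PW by auto
  have or: "orientation E D" using D by (simp add: pfaffian_orientation_def)
  have "cycle_edges (x # W) = path_edges (x # W @ [x])" by (rule cycle_edges_Cons)
  also have "\<dots> = insert {x, hd W} (insert {last W, x} (path_edges W))"
    using W by (auto simp: path_edges_Cons_ne path_edges_split)
  finally have cyc: "is_cycle V E (x # W)"
    using PW pe a unfolding is_cycle_def by (auto simp: Suc_le_eq)
  have "hd P = t" using a PW by (cases P) auto
  moreover have "last P \<in> B" using pe a(3) T(3) edge_sides[of "last P" x] not_both_sides by blast
  moreover have "path_edges P \<subseteq> E" "distinct P" using pe a PW by auto
  ultimately have "\<exists>M. perfect_matching (set P) (induced_edges E (set P)) M"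
    using even_path_matching t by blast
  moreover have "V - set (x # W) = set P" using a PW by auto
  ultimately have "central_cycle V E (x # W)" using cyc unfolding central_cycle_def by simp
  then have "odd (card (cycle_arcs (x # W) \<inter> D))" using D by (simp add: pfaffian_orientation_def)
  then have "walk_parity D (x # W @ [x])" using odd_cycle_arcs_iff a PW by (metis distinct_append)
  \<comment> \<open>The closed walk splits into its two arcs at \<open>x\<close> and the walk
    \<open>W\<close>. Turning the arc out of \<open>x\<close> around makes the odd total even, which
    together with the telescoped switches says that the two signs agree.\<close>
  then have "((x, hd W) \<in> D) \<noteq> (walk_parity D W \<noteq> ((last W, x) \<in> D))"
    using W walk_parity_snoc[of W D x] by (cases W) auto
  moreover have "walk_parity D W \<longleftrightarrow> \<epsilon> (hd W) \<noteq> \<epsilon> (last W)"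
    using walk_parity_alternating[OF or alt a(3) W] a(1) PW pe T(2) Q(2) l tW by auto
  moreover have "(x, hd W) \<in> D \<longleftrightarrow> (hd W, x) \<notin> D"
    using or pe a(3) unfolding orientation_def by (metis insert_commute insertI1 insertI2 subsetD)
  ultimately show ?thesis using l by (auto simp: sign_def)
qed

text \<open>Among the vertices of \<open>A\<close> only \<open>x\<close> has its path edges changed,
  and there one edge is exchanged for another of the same sign.\<close>

lemma turn_alternating:
  assumes "pfaffian_orientation V E D" "alternating D \<epsilon> Q" "anchored Q" "last Q \<in> B" "turn Q x Q'"
  shows "alternating D \<epsilon> Q'"
proof -
  note T = turnD[OF assms(3-5)] and s = turn_sign[OF assms]
  have "sign D \<epsilon> b y \<noteq> sign D \<epsilon> c y"
    if y: "y \<in> A - {t}" and bc: "{b, y} \<in> path_edges Q'" "{c, y} \<in> path_edges Q'" "b \<noteq> c" for y b c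
  proof (cases "y = x")
    case False
    then have "{b, y} \<in> path_edges Q" "{c, y} \<in> path_edges Q"
      using bc T(9) y assms(4) not_both_sides[of y] by (auto simp: doubleton_eq_iff)
    then show ?thesis using assms(2) y bc unfolding alternating_def by blast
  next
    case True
    have ne: "b \<noteq> last Q'" "c \<noteq> last Q'" using bc T(9) True by auto
    have Qb: "d = last Q \<or> {d, x} \<in> path_edges Q" if "{d, x} \<in> path_edges Q'" for d
      using that T(9) by (auto simp: doubleton_eq_iff)
    have alt: "sign D \<epsilon> d x \<noteq> sign D \<epsilon> d' x" if "{d, x} \<in> path_edges Q" "{d', x} \<in> path_edges Q" "d \<noteq> d'" for d d'
      using that assms(2) y True unfolding alternating_def by blast
    show ?thesis using Qb[of b] Qb[of c] bc True ne alt[of b c] alt[of b "last Q'"] alt[of c "last Q'"] T(7) s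
      by metis
  qed
  then show ?thesis unfolding alternating_def by blast
qed

text \<open>The third edge at \<open>x\<close>, to \<open>z\<close>, has the sign opposite to the
  two exchanged edges. The edges exchanged by the other turn at \<open>x\<close> share a sign too,
  and only one pair of edges at \<open>x\<close> does so.\<close>

lemma turn_pair:
  assumes D: "pfaffian_orientation V E D"
    and 1: "alternating D \<epsilon> Q" "anchored Q" "last Q \<in> B" "turn Q x Q'"
    and 2: "alternating D \<epsilon> R" "anchored R" "last R \<in> B" "turn R x R'"
  shows "{last Q, last Q'} = {last R, last R'}"
proof -
  note T1 = turnD[OF 1(2-4)] and T2 = turnD[OF 2(2-4)]
  obtain z where z: "z \<noteq> last Q'" "{z, x} \<in> path_edges Q" using T1(10) by blast
  have E: "{z, x} \<in> E" "{last Q, x} \<in> E" "{last Q', x} \<in> E" "{last R, x} \<in> E" "{last R', x} \<in> E"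
    using z T1 T2 anchoredD(3)[OF 1(2)] anchoredD(3)[OF 2(2)] by blast+
  have zz: "z \<noteq> last Q" using z T1(6) by auto
  have s: "sign D \<epsilon> z x \<noteq> sign D \<epsilon> (last Q') x"
    using 1(1) T1 z unfolding alternating_def by blast
  have n: "c = z \<or> c = last Q \<or> c = last Q'" if "{c, x} \<in> E" for c
    using three_neighbors[OF E(1-3) zz z(1) T1(8) that] .
  show ?thesis
    using n[OF E(4)] n[OF E(5)] s turn_sign[OF D 1] turn_sign[OF D 2] T1(8) T2(8) by auto
qed

subsection \<open>Runs of the method\<close>

lemma run_anchored:
  assumes "lollipop_run V E H s t Qs" "cycle_edges H \<subseteq> E" "i < length Qs"
  shows "anchored (Qs ! i) \<and> last (Qs ! i) \<in> B"
  using assms(3)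
proof (induction i)
  case 0
  have "start_path V E H s t (Qs ! 0)" using assms(1) by (simp add: lollipop_run_def)
  then have "anchored (Qs ! 0)" "{t, last (Qs ! 0)} \<in> E" using assms(2) unfolding start_path_def by auto
  then show ?case using edge_sides[of t "last (Qs ! 0)"] t not_both_sides[of t] by auto
next
  case (Suc i)
  then have Q: "anchored (Qs ! i)" "last (Qs ! i) \<in> B" by auto
  have "lollipop_step V E s t (Qs ! i) (Qs ! Suc i)"
    using assms(1) Suc.prems by (simp add: lollipop_run_def)
  then obtain x where "turn (Qs ! i) x (Qs ! Suc i)" using lollipop_step_iff_turn[OF Q] by blast
  then show ?case using turnD(1,2)[OF Q] by blast
qed

text \<open>The colours alternate along the path. For a Hamiltonian path this identifies
  \<open>2 * card B\<close> with the number of vertices.\<close>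

lemma card_side_of_path:
  assumes "distinct L" "path_edges L \<subseteq> E" "L \<noteq> [] \<Longrightarrow> hd L \<in> A \<and> last L \<in> B"
  shows "2 * card (set L \<inter> B) = length L"
  using assms
proof (induction L rule: induct_list012)
  case (2 a)
  then show ?case using not_both_sides by auto
next
  case (3 a b L)
  have ab: "{a, b} \<in> E" "a \<in> A" "a \<notin> B" using 3 not_both_sides by auto
  then have b: "b \<in> B" "b \<notin> A" using edge_sides not_both_sides by blast+
  have "hd L \<in> A \<and> last L \<in> B" if "L \<noteq> []"
    using 3(4,5) b that edge_sides[of b "hd L"] by (auto simp: path_edges_Cons_ne)
  moreover have "path_edges L \<subseteq> E" using 3(4) by (cases "L = []") (auto simp: path_edges_Cons_ne)
  ultimately have "2 * card (set L \<inter> B) = length L" using 3(1,3) by auto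
  moreover have "set (a # b # L) \<inter> B = insert b (set L \<inter> B)" using ab b by auto
  ultimately show ?case using 3(3) by simp
qed auto

lemma last_path_edge:
  assumes "anchored Q"
  obtains p where "\<And>c. {c, last Q} \<in> path_edges Q \<longleftrightarrow> c = p"
proof -
  obtain L where L: "Q = t # s # L" using assms by (auto simp: anchored_path_def)
  then have "butlast Q \<noteq> []" by simp
  then have "Q = butlast (butlast Q) @ [last (butlast Q), last Q]"
    using L by (metis append_butlast_last_id append.assoc append_Cons append_Nil list.distinct(1))
  then show ?thesis
    using path_edges_last[of "butlast (butlast Q)" "last (butlast Q)" "last Q"] anchoredD(1)[OF assms] that
    by metis
qed

text \<open>The current end has degree three and one path edge, which leaves two candidates
  \<open>x\<close>, \<open>y\<close>. Initially at most one of them is \<open>t\<close>; later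
  neither is, and the two turns yield different paths, at most one of which is the previous
  path.\<close>

lemma run_extend:
  assumes run: "lollipop_run V E H s t Qs" and H: "cycle_edges H \<subseteq> E" and "\<not> terminated E t Qs"
  obtains Q where "lollipop_run V E H s t (Qs @ [Q])"
proof -
  have ne: "Qs \<noteq> []" using run by (simp add: lollipop_run_def)
  define k where "k = length Qs - 1"
  have k: "length Qs = Suc k" using ne by (simp add: k_def)
  define R where "R = Qs ! k"
  have R: "anchored R" "last R \<in> B" using run_anchored[OF run H, of k] k by (auto simp: R_def)
  have lastR: "last Qs = R" using ne by (simp add: R_def k_def last_conv_nth)
  obtain p where pe: "\<And>c. {c, last R} \<in> path_edges R \<longleftrightarrow> c = p" using last_path_edge[OF R(1)] by blast
  then have "{p, last R} \<in> E" using anchoredD(3)[OF R(1)] by blast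
  then obtain x y where xy: "{x, last R} \<in> E" "{y, last R} \<in> E" "x \<noteq> y" "x \<noteq> p" "y \<noteq> p"
    using two_other_neighbors by metis
  have free: "\<exists>Q'. turn R z Q'" if "{z, last R} \<in> E" "z \<noteq> p" "z \<noteq> t" for z
    using turn_if_free[OF R(1), of z] that pe[of z] by (metis insert_commute)
  have "\<exists>Q'. lollipop_step V E s t R Q' \<and> (1 \<le> k \<longrightarrow> Q' \<noteq> Qs ! (k - 1) \<and> {last R, t} \<notin> E)"
  proof (cases "k = 0")
    case True
    obtain z where "z \<in> {x, y}" "z \<noteq> t" using xy(3) by blast
    then have "\<exists>Q'. turn R z Q'" using free xy by auto
    then show ?thesis using lollipop_step_iff_turn[OF R] True by auto
  next
    case False
    then have nt: "{last R, t} \<notin> E" using assms(3) lastR k by (simp add: terminated_def steps_def)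
    then have "x \<noteq> t" "y \<noteq> t" using xy by (auto simp: insert_commute)
    then obtain Q1 Q2 where Q: "turn R x Q1" "turn R y Q2" using free xy by metis
    \<comment> \<open>Only the turn at \<open>y\<close> inserts the edge from the end to
      \<open>y\<close>.\<close>
    have "{last R, y} \<notin> path_edges Q1"
      using turnD(9)[OF R Q(1)] turnD(6)[OF R Q(2)] xy(3) by (auto simp: doubleton_eq_iff)
    moreover have "{last R, y} \<in> path_edges Q2"
      using turnD(8,9)[OF R Q(2)] by (auto simp: doubleton_eq_iff)
    ultimately have "Q1 \<noteq> Q2" by auto
    then obtain Q' where "Q' \<in> {Q1, Q2}" "Q' \<noteq> Qs ! (k - 1)" by blast
    then show ?thesis using lollipop_step_iff_turn[OF R] Q nt by auto
  qed
  then obtain Q' where Q': "lollipop_step V E s t R Q'"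
    "1 \<le> k \<Longrightarrow> Q' \<noteq> Qs ! (k - 1) \<and> {last R, t} \<notin> E" by auto
  have "lollipop_step V E s t ((Qs @ [Q']) ! i) ((Qs @ [Q']) ! Suc i)" if "Suc i < length (Qs @ [Q'])" for i
    using that run k Q'(1) by (cases "i = k") (auto simp: lollipop_run_def nth_append R_def)
  moreover have "(Qs @ [Q']) ! Suc i \<noteq> (Qs @ [Q']) ! (i - 1) \<and> {last ((Qs @ [Q']) ! i), t} \<notin> E"
    if "1 \<le> i" "Suc i < length (Qs @ [Q'])" for i
  proof (cases "i = k")
    case True
    then show ?thesis using Q'(2) that k by (simp add: nth_append R_def)
  next
    case False
    then have "Suc i < length Qs" using that k by simp
    moreover from this have "i - 1 < length Qs" by simp
    moreover from calculation have "(Qs @ [Q']) ! Suc i = Qs ! Suc i" "(Qs @ [Q']) ! i = Qs ! i"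
      "(Qs @ [Q']) ! (i - 1) = Qs ! (i - 1)"
      by (simp_all add: nth_append)
    ultimately show ?thesis using run that(1) unfolding lollipop_run_def by presburger
  qed
  ultimately have "lollipop_run V E H s t (Qs @ [Q'])"
    using run ne by (auto simp: lollipop_run_def nth_append)
  then show ?thesis using that by blast
qed

text \<open>Instance of the retracing bound: the walk consists of the successive ends
  \<open>y i\<close>, passes through the turning vertices \<open>X i\<close>, and an edge is free
  when it lies outside the current path.\<close>

lemma run_length:
  assumes D: "pfaffian_orientation V E D" and H: "cycle_edges H \<subseteq> E"
    and run: "lollipop_run V E H s t Qs"
  shows "steps Qs \<le> 2 * card B"
proof -
  define h where "h = steps Qs"
  have len: "length Qs = Suc h" using run by (simp add: h_def steps_def lollipop_run_def)
  define y where "y i = last (Qs ! i)" for i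
  have Q: "anchored (Qs ! i)" "last (Qs ! i) \<in> B" if "i \<le> h" for i
    using run_anchored[OF run H, of i] that len by auto
  have "\<exists>x. turn (Qs ! i) x (Qs ! Suc i)" if "i < h" for i
    using lollipop_step_iff_turn[OF Q] run that len by (simp add: lollipop_run_def)
  then obtain X where X: "\<And>i. i < h \<Longrightarrow> turn (Qs ! i) (X i) (Qs ! Suc i)" by metis
  have T: "turn (Qs ! i) (X i) (Qs ! Suc i)" "anchored (Qs ! i)" "last (Qs ! i) \<in> B" if "i < h" for i
    using X Q that by auto
  note TD = turnD[OF T(2,3,1)]
  obtain \<epsilon> where \<epsilon>: "alternating D \<epsilon> (Qs ! 0)" using alternating_exists Q(1)[of 0] by blast
  have alt: "alternating D \<epsilon> (Qs ! i)" if "i \<le> h" for i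
    using that
  proof (induction i)
    case (Suc i)
    then show ?case using turn_alternating[OF D, of \<epsilon> "Qs ! i"] T[of i] by auto
  qed (use \<epsilon> in simp)
  define free where "free i b x \<longleftrightarrow> {b, x} \<in> E \<and> {b, x} \<notin> path_edges (Qs ! i)" for i b x
  have leave: "free i (y i) (X i)" if "i < h" for i
    using TD(5,6)[OF that that that] by (simp add: free_def y_def)
  have used: "{y (Suc i), X i} \<in> path_edges (Qs ! i)" if "i < h" for i
    using TD(7)[OF that that that] by (simp add: y_def)
  have pe: "path_edges (Qs ! Suc i) = insert {y i, X i} (path_edges (Qs ! i)) - {{y (Suc i), X i}}"
    if "i < h" for i
    using TD(9)[OF that that that] by (simp add: y_def)
  have arrive: "free (Suc i) (y (Suc i)) (X i)" if "i < h" for i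
    using used[OF that] pe[OF that] anchoredD(3)[OF T(2)[OF that]] by (auto simp: free_def)
  have noback: "X (Suc i) \<noteq> X i" if "Suc i < h" for i
  proof
    assume "X (Suc i) = X i"
    then have "Qs ! Suc (Suc i) = Qs ! i"
      using turn_back[OF T(2) T(1), of i] T(1)[of "Suc i"] that by auto
    moreover have "Qs ! Suc (Suc i) \<noteq> Qs ! (Suc i - 1)"
      using run len that unfolding lollipop_run_def by (metis Suc_less_eq le_add1 plus_1_eq_Suc)
    ultimately show False by simp
  qed
  have "finite B" using simple sides by (auto simp: simple_graph_def)
  have "h \<le> 2 * card B"
  proof (rule retracing_walk_bound[where y = y and X = X and free = free and B = B])
    fix i b x
    assume i: "i < h" "free i b x" "\<not> free (Suc i) b x" "b \<in> B"
    \<comment> \<open>A step takes only the edge from its end into the path; \<open>b\<close> in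
      \<open>B\<close> decides which endpoint is \<open>b\<close>.\<close>
    then have "{b, x} = {y i, X i}" using pe[OF i(1)] by (auto simp: free_def)
    moreover have "b \<noteq> X i" using TD(3)[OF i(1) i(1) i(1)] i(4) not_both_sides by blast
    ultimately show "b = y i \<and> x = X i" by (auto simp: doubleton_eq_iff)
  next
    fix i z
    assume i: "Suc i < h" "free (Suc i) (y (Suc i)) z"
    \<comment> \<open>The path neighbour \<open>p\<close>, \<open>X i\<close> and
      \<open>X (Suc i)\<close> are distinct, hence all three neighbours of the end.\<close>
    obtain p where p: "{p, y (Suc i)} \<in> path_edges (Qs ! Suc i)"
      using last_path_edge[OF T(2)[OF i(1)]] unfolding y_def by blast
    have a: "free (Suc i) (y (Suc i)) (X i)" "free (Suc i) (y (Suc i)) (X (Suc i))"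
      using arrive[of i] leave[of "Suc i"] i by auto
    have "{p, y (Suc i)} \<in> E" using p anchoredD(3)[OF T(2)[OF i(1)]] by blast
    moreover have "p \<noteq> X i" "p \<noteq> X (Suc i)" "z \<noteq> p"
      using a i(2) p by (auto simp: free_def insert_commute)
    moreover have "{X i, y (Suc i)} \<in> E" "{X (Suc i), y (Suc i)} \<in> E" "{z, y (Suc i)} \<in> E"
      using a i(2) by (auto simp: free_def insert_commute)
    ultimately show "z = X i \<or> z = X (Suc i)"
      using three_neighbors[of p "y (Suc i)" "X i" "X (Suc i)" z] noback[OF i(1)] by auto
  next
    fix i j
    assume "i < h" "j < h" "X i = X j"
    then show "{y i, y (Suc i)} = {y j, y (Suc j)}"
      using turn_pair[OF D alt[of i] T(2)[of i] T(3)[of i] T(1)[of i] alt[of j] T(2)[of j] T(3)[of j]] T(1)[of j]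
      by (simp add: y_def)
  next
    fix i
    assume i: "0 < i" "i < h"
    \<comment> \<open>The initial end is adjacent to \<open>t\<close>, whereas every intermediate
      end failed the stopping test.\<close>
    have "{t, y 0} \<in> E" using run H unfolding lollipop_run_def start_path_def y_def by auto
    moreover have "{y i, t} \<notin> E" using run i len unfolding lollipop_run_def y_def by auto
    ultimately show "y i \<noteq> y 0" by (auto simp: insert_commute)
  qed (use \<open>finite B\<close> Q arrive used noback in \<open>auto simp: y_def free_def\<close>)
  then show ?thesis by (simp add: h_def)
qed

end

section \<open>Existence of the initial path and assembly of the bound\<close>

lemma start_path_exists:
  assumes H: "hamiltonian_cycle V E H" and st: "{s, t} \<in> cycle_edges H"
  obtains Q where "start_path V E H s t Q"
proof -
  have H': "3 \<le> length H" "distinct H" "set H = V" "cycle_edges H \<subseteq> E"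
    using H by (auto simp: hamiltonian_cycle_def is_cycle_def)
  have "t \<in> set H"
  proof (cases H)
    case (Cons a L)
    then show ?thesis using st path_edges_subsetD[of "{s, t}" "a # L @ [a]" t] by (auto simp: cycle_edges_Cons)
  qed (use H' in simp)
  then obtain L where L: "cycle_edges H = path_edges (t # L @ [t])" "set H = insert t (set L)"
    "length H = Suc (length L)" "distinct H \<longleftrightarrow> distinct (t # L)"
    using cycle_edges_rotate by metis
  have ne: "L \<noteq> []" using L(3) H'(1) by auto
  have edges: "path_edges (t # K @ [t]) = insert {t, last K} (path_edges (t # K))" if "K \<noteq> []" for K
    using path_edges_split[of "t # K" "[t]"] that by (auto simp: insert_commute)
  \<comment> \<open>Of the two directions in which the opened cycle can be read, \<open>K\<close> is
    the one that puts \<open>s\<close> right after \<open>t\<close>.\<close>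
  have "\<exists>K. K \<noteq> [] \<and> hd K = s \<and> path_edges (t # K @ [t]) = cycle_edges H \<and> set K = set L \<and> distinct K
    \<and> length K = length L"
  proof -
    have "{s, t} \<notin> path_edges L" using path_edges_subsetD[of "{s, t}" L t] L(4) H'(2) by auto
    then have "s = hd L \<or> s = last L"
      using st L(1) edges[OF ne] ne by (auto simp: path_edges_Cons_ne doubleton_eq_iff)
    then show ?thesis
    proof
      assume "s = hd L"
      then show ?thesis using L H' ne by (intro exI[of _ L]) auto
    next
      assume "s = last L"
      moreover have "path_edges (t # rev L @ [t]) = path_edges (t # L @ [t])"
        using path_edges_rev[of "t # L @ [t]"] by simp
      ultimately show ?thesis using L H' ne by (intro exI[of _ "rev L"]) (auto simp: hd_rev)
    qed
  qed
  then obtain K where K: "K \<noteq> []" "hd K = s" "path_edges (t # K @ [t]) = cycle_edges H" "set K = set L"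
    "distinct K" "length K = length L" by blast
  obtain R where R: "K = s # R" using K by (cases K) auto
  \<comment> \<open>A cycle has at least three vertices, so the other neighbour of \<open>t\<close>
    on it is not \<open>s\<close>.\<close>
  have "R \<noteq> []" using R K(6) L(3) H'(1) by auto
  then have ls: "last K \<noteq> s" using R K(5) by auto
  have tK: "t \<notin> set K" using K(4) L(4) H'(2) by auto
  have "{t, last K} \<notin> path_edges (t # K)"
    using K(1,2) ls tK path_edges_subsetD[of "{t, last K}" K t]
    by (auto simp: path_edges_Cons_ne doubleton_eq_iff)
  moreover have ce: "cycle_edges H = insert {t, last K} (path_edges (t # K))" using edges[OF K(1)] K(3) by simp
  ultimately have "path_edges (t # K) = cycle_edges H - {{t, last K}}" by auto
  moreover have "anchored_path V E s t (t # K)"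
    unfolding anchored_path_def hamiltonian_path_def using R K L H' tK ce by auto
  ultimately have "start_path V E H s t (t # K)"
    unfolding start_path_def using K(1) ls ce by auto
  then show ?thesis using that by blast
qed

theorem theorem1p3:
  fixes V :: "'a set" and E :: "'a set set" and H :: "'a list" and s t :: 'a and n :: nat
  assumes "simple_graph V E" and "card V = n"
    and "cubic V E" and "bipartite V E" and "pfaffian V E"
    and "hamiltonian_cycle V E H" and "{s, t} \<in> cycle_edges H"
  shows "lollipop_terminates_within V E H s t n"
proof -
  have H: "set H = V" "cycle_edges H \<subseteq> E" "3 \<le> length H"
    using assms(6) by (auto simp: hamiltonian_cycle_def is_cycle_def)
  have stE: "{s, t} \<in> E" using assms(7) H by blast
  \<comment> \<open>The colour classes are interchangeable and can be named so that \<open>t\<close>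
    lies in \<open>A\<close>.\<close>
  obtain A B where AB: "A \<union> B = V" "A \<inter> B = {}" "\<And>e. e \<in> E \<Longrightarrow> \<exists>a\<in>A. \<exists>b\<in>B. e = {a, b}" "t \<in> A"
  proof -
    obtain A B where AB: "A \<union> B = V" "A \<inter> B = {}" "\<And>e. e \<in> E \<Longrightarrow> \<exists>a\<in>A. \<exists>b\<in>B. e = {a, b}"
      using assms(4) unfolding bipartite_def by - (elim exE conjE, rule that, auto)
    have "t \<in> A \<or> t \<in> B" using AB(3)[OF stE] by (auto simp: doubleton_eq_iff)
    then show ?thesis
    proof
      assume "t \<in> B"
      moreover have "\<exists>b\<in>B. \<exists>a\<in>A. e = {b, a}" if "e \<in> E" for e using AB(3)[OF that] by (metis insert_commute)
      ultimately show ?thesis using that[of B A] AB by blast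
    qed (use that AB in blast)
  qed
  interpret cubic_bipartite V E A B s t
    using assms AB by unfold_locales auto
  obtain D where D: "pfaffian_orientation V E D" using assms(5) by (auto simp: pfaffian_def)
  obtain Q where "start_path V E H s t Q" using start_path_exists[OF assms(6,7)] by blast
  then have run0: "lollipop_run V E H s t [Q]" by (simp add: lollipop_run_def)
  then have Q: "anchored Q" "last Q \<in> B" using run_anchored[OF run0 H(2), of 0] by auto
  have "V \<inter> B = B" using AB(1) by blast
  then have "2 * card B = n"
    using card_side_of_path[of Q] anchoredD[OF Q(1)] Q(2) t assms(2) distinct_card[of Q] by auto
  then have bound: "steps Qs \<le> n" if "lollipop_run V E H s t Qs" for Qs
    using run_length[OF D H(2) that] by simp
  have "\<exists>Rs. lollipop_run V E H s t (Qs @ Rs) \<and> terminated E t (Qs @ Rs)"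
    if "lollipop_run V E H s t Qs" for Qs
    using that
  \<comment> \<open>The bound holds for the extended run as well, so each extension strictly
    decreases \<open>n - steps Qs\<close>, and extending must end in termination.\<close>
  proof (induction "n - steps Qs" arbitrary: Qs rule: less_induct)
    case less
    show ?case
    proof (cases "terminated E t Qs")
      case True
      then show ?thesis using less.prems by (intro exI[of _ "[]"]) simp
    next
      case False
      then obtain Q where Q: "lollipop_run V E H s t (Qs @ [Q])"
        using run_extend[OF less.prems H(2)] by blast
      have "Qs \<noteq> []" using less.prems by (simp add: lollipop_run_def)
      then have "steps (Qs @ [Q]) = Suc (steps Qs)" by (cases Qs) (auto simp: steps_def)
      then have "n - steps (Qs @ [Q]) < n - steps Qs" using bound[OF Q] by simp
      from less.hyps[OF this Q] show ?thesis by auto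
    qed
  qed
  then show ?thesis
    unfolding lollipop_terminates_within_def using run0 bound by blast
qed

end
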